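(* Let $G$ be a simple graph with vertex set $\{v_1,\dots,v_n\}$, $n\ge 2$, with no isolated vertices, and let $d_i$ denote the degree of $v_i$. Let $\mathscr{L}(G)=[\ell_{ij}]$ be the normalized Laplacian matrix of $G$, i.e. $\ell_{ii}=1$, $\ell_{ij}=-\frac{1}{\sqrt{d_id_j}}$ if $v_i\sim v_j$, and $\ell_{ij}=0$ otherwise, with eigenvalues $\lambda_1(\mathscr{L}(G))\ge\lambda_2(\mathscr{L}(G))\ge\cdots\ge\lambda_n(\mathscr{L}(G))$. Put $$m=1+\frac{2}{n}\sum_{i\sim j,\ i<j}\frac{1}{d_id_j},$$ where the sum runs over all pairs $i<j$ with $v_i\sim v_j$. Then $$\lambda_n(\mathscr{L}(G))\le \sqrt{m+\sqrt{\frac{\operatorname{tr}[\mathscr{L}(G)]^{4}-nm^{2}}{n(n-1)}}},$$ $$\lambda_1(\mathscr{L}(G))\ge \sqrt{m+\sqrt{\frac{\operatorname{tr}[\mathscr{L}(G)]^{4}-nm^{2}}{n(n-1)}}},$$ $$\lambda_1(\mathscr{L}(G))\le \sqrt{m+\sqrt{\left(\frac{\operatorname{tr}[\mathscr{L}(G)]^{4}}{n}-m^{2}\right)(n-1)}}.$$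
   Context: $v_i\sim v_j$ means $v_i$ and $v_j$ are adjacent. $\operatorname{tr}[\mathscr{L}(G)]^4$ denotes the trace of the fourth power of the matrix $\mathscr{L}(G)$. Note that $m=\operatorname{tr}[\mathscr{L}(G)]^2/n$. *)

theory Defs
  imports
    Complex_Main
    "HOL-Library.Multiset"
    "HOL-Computational_Algebra.Polynomial"
    "Graph_Theory.Pair_Digraph"
    "Jordan_Normal_Form.Char_Poly"
begin

text \<open>
  A simple graph is a \<^locale>\<open>pair_graph\<close>: a finite symmetric loop-free digraph whose arcs are
  pairs of vertices, an edge being represented by its two opposite arcs. The degree of a vertex
  is therefore its out-degree.
\<close>

definition deg :: "'a pair_pre_digraph \<Rightarrow> 'a \<Rightarrow> nat" where
  "deg G x = out_degree (with_proj G) x"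

definition adj :: "'a pair_pre_digraph \<Rightarrow> 'a \<Rightarrow> 'a \<Rightarrow> bool" where
  "adj G x y \<longleftrightarrow> (x, y) \<in> parcs G"

text \<open>
  Vertices are enumerated from 0, in accordance with the matrix indices: \<open>v 0, \<dots>, v (n - 1)\<close>.
\<close>

definition normalized_laplacian :: "'a pair_pre_digraph \<Rightarrow> nat \<Rightarrow> (nat \<Rightarrow> 'a) \<Rightarrow> real mat" where
  "normalized_laplacian G n v = mat n n (\<lambda>(i, j).
     if i = j then 1
     else if adj G (v i) (v j) then - (1 / sqrt (real (deg G (v i)) * real (deg G (v j))))
     else 0)"

definition mat_trace :: "'b :: comm_monoid_add mat \<Rightarrow> 'b" where
  "mat_trace A = (\<Sum>i<dim_row A. A $$ (i, i))"

text \<open>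
  \<open>eigval A k\<close> is the \<open>k\<close>-th largest real eigenvalue of \<open>A\<close> (\<open>k = 1, 2, \<dots>\<close>), counted with
  algebraic multiplicity. For a symmetric matrix of dimension \<open>n\<close> all roots of the characteristic
  polynomial are real, so that the list has length \<open>n\<close>.
\<close>

definition eigvals_desc :: "real mat \<Rightarrow> real list" where
  "eigvals_desc A = rev (sorted_list_of_multiset (proots (char_poly A)))"

definition eigval :: "real mat \<Rightarrow> nat \<Rightarrow> real" where
  "eigval A k = eigvals_desc A ! (k - 1)"

end

theory Submission
  imports Defs "Jordan_Normal_Form.Schur_Decomposition"
begin

text \<open>
  Apply the inequalities of Wolkowicz and Styan, which locate the extreme entries of a finite
  family of reals by means of its mean and its variance, to the squares of the eigenvalues:
  their mean is \<open>m\<close> and the sum of their squares is the trace of the fourth power. Taking square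
  roots is monotone because the normalized Laplacian has no negative eigenvalue.
\<close>

section \<open>Traces of powers and eigenvalues\<close>

lemma mat_trace_mult_commute:
  fixes A B :: "'b::comm_ring_1 mat"
  assumes A: "A \<in> carrier_mat n n" and B: "B \<in> carrier_mat n n"
  shows "mat_trace (A * B) = mat_trace (B * A)"
proof -
  have "mat_trace (A * B) = (\<Sum>i<n. \<Sum>j<n. A $$ (i, j) * B $$ (j, i))"
    using A B by (auto simp: mat_trace_def scalar_prod_def atLeast0LessThan intro!: sum.cong)
  also have "\<dots> = (\<Sum>j<n. \<Sum>i<n. B $$ (j, i) * A $$ (i, j))"
    by (subst sum.swap) (simp add: mult.commute)
  also have "\<dots> = mat_trace (B * A)"
    using A B by (auto simp: mat_trace_def scalar_prod_def atLeast0LessThan intro!: sum.cong)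
  finally show ?thesis .
qed

lemma mat_trace_similar:
  fixes A B :: "'b::comm_ring_1 mat"
  assumes A: "A \<in> carrier_mat n n" and wit: "similar_mat_wit A B P Q"
  shows "mat_trace A = mat_trace B"
proof -
  note w = similar_mat_witD2[OF A wit]
  have "mat_trace A = mat_trace (P * (B * Q))"
    using w by (simp add: assoc_mult_mat[of _ n n _ n _ n])
  also have "\<dots> = mat_trace (B * Q * P)"
    using w by (intro mat_trace_mult_commute[of _ n]) auto
  also have "B * Q * P = B"
    using w by (simp add: assoc_mult_mat[of _ n n _ n _ n])
  finally show ?thesis .
qed

text \<open>A term \<open>(B ^\<^sub>m k) $$ (i, l) * B $$ (l, j)\<close> can be nonzero only if i
  \<le> l \<le> j. For j < i no index \<open>l\<close> survives, for j = i only l = i. One induction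
  carries both claims, since the diagonal one relies on the vanishing below the diagonal.\<close>

lemma upper_triangular_power:
  fixes B :: "'b::comm_ring_1 mat"
  assumes B: "B \<in> carrier_mat n n" and up: "upper_triangular B"
  shows "upper_triangular (B ^\<^sub>m k)" and "i < n \<Longrightarrow> (B ^\<^sub>m k) $$ (i, i) = (B $$ (i, i)) ^ k"
proof -
  have "(\<forall>i<n. \<forall>j<i. (B ^\<^sub>m k) $$ (i, j) = 0) \<and> (\<forall>i<n. (B ^\<^sub>m k) $$ (i, i) = (B $$ (i, i)) ^ k)"
  proof (induction k)
    case 0
    then show ?case using B by auto
  next
    case (Suc k)
    have C: "B ^\<^sub>m k \<in> carrier_mat n n" using B by simp
    have entry: "(B ^\<^sub>m Suc k) $$ (i, j) = (\<Sum>l<n. (B ^\<^sub>m k) $$ (i, l) * B $$ (l, j))"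
      if "i < n" "j < n" for i j
      using that B C by (simp add: scalar_prod_def atLeast0LessThan)
    have low: "B $$ (i, j) = 0" if "j < i" "i < n" for i j
      using up B that by auto
    have "(B ^\<^sub>m Suc k) $$ (i, j) = 0" if "i < n" "j < i" for i j
    proof -
      have "(B ^\<^sub>m k) $$ (i, l) * B $$ (l, j) = 0" if "l < n" for l
        using Suc.IH low[of j l] \<open>i < n\<close> \<open>j < i\<close> that by (cases "l < i") auto
      then show ?thesis using entry[of i j] that by (simp del: pow_mat.simps)
    qed
    moreover have "(B ^\<^sub>m Suc k) $$ (i, i) = (B $$ (i, i)) ^ Suc k" if "i < n" for i
    proof -
      have z: "(B ^\<^sub>m k) $$ (i, l) * B $$ (l, i) = 0" if "l < n" "l \<noteq> i" for l
        using Suc.IH low[of i l] \<open>i < n\<close> that by (cases "l < i") auto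
      have "(B ^\<^sub>m Suc k) $$ (i, i) = (\<Sum>l\<in>{i}. (B ^\<^sub>m k) $$ (i, l) * B $$ (l, i))"
        unfolding entry[OF that that] by (rule sum.mono_neutral_right) (use that z in auto)
      then show ?thesis using Suc.IH that by (simp del: pow_mat.simps add: mult.commute)
    qed
    ultimately show ?case by blast
  qed
  moreover have "dim_row (B ^\<^sub>m k) = n" using B by (simp add: pow_mat_dim)
  ultimately show "upper_triangular (B ^\<^sub>m k)"
    and "i < n \<Longrightarrow> (B ^\<^sub>m k) $$ (i, i) = (B $$ (i, i)) ^ k"
    by (auto intro!: upper_triangularI)
qed

text \<open>By Schur decomposition \<open>A\<close> is similar to an upper triangular matrix with
  diagonal \<open>es\<close>. Similarity passes to powers and preserves the trace, and powers of a
  triangular matrix act entrywise on the diagonal.\<close>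

lemma mat_trace_power_eq_sum_list:
  fixes A :: "'b::conjugatable_ordered_field mat"
  assumes A: "A \<in> carrier_mat n n" and cp: "char_poly A = (\<Prod>e\<leftarrow>es. [:- e, 1:])"
  shows "mat_trace (A ^\<^sub>m k) = (\<Sum>e\<leftarrow>es. e ^ k)"
proof -
  obtain B P Q where sd: "schur_decomposition A es = (B, P, Q)"
    by (cases "schur_decomposition A es") auto
  from schur_decomposition[OF A cp sd] have wit: "similar_mat_wit A B P Q"
    and up: "upper_triangular B" and diag: "diag_mat B = es" by auto
  from similar_mat_witD2[OF A wit] have B: "B \<in> carrier_mat n n" by auto
  have "mat_trace (A ^\<^sub>m k) = mat_trace (B ^\<^sub>m k)"
    by (rule mat_trace_similar[of _ n, OF _ similar_mat_wit_pow[OF wit]]) (use A in simp)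
  also have "\<dots> = (\<Sum>i<n. (B $$ (i, i)) ^ k)"
    using B upper_triangular_power(2)[OF B up] by (auto simp: mat_trace_def pow_mat_dim)
  also have "\<dots> = (\<Sum>e\<leftarrow>es. e ^ k)"
    unfolding diag[symmetric] using B
    by (simp add: diag_mat_def o_def interv_sum_list_conv_sum_set_nat atLeast0LessThan)
  finally show ?thesis .
qed

section \<open>Real spectrum of symmetric matrices\<close>

text \<open>For an eigenvector \<open>x\<close>, the Hermitian form \<open>q\<close> of
  \<open>A\<close> at \<open>x\<close> equals \<open>c\<close> times the squared norm
  \<open>r\<close> of \<open>x\<close>. Since \<open>q\<close> is real and \<open>r\<close> is real
  and nonzero, so is their quotient \<open>c\<close> real.\<close>

lemma symmetric_eigenvalue_real:
  fixes A :: "real mat"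
  assumes A: "A \<in> carrier_mat n n"
    and sym: "\<And>i j. i < n \<Longrightarrow> j < n \<Longrightarrow> A $$ (i, j) = A $$ (j, i)"
    and ev: "eigenvalue (map_mat complex_of_real A) c"
  shows "c \<in> \<real>"
proof -
  from ev A obtain x where x: "x \<in> carrier_vec n" "x \<noteq> 0\<^sub>v n"
    and eq: "map_mat complex_of_real A *\<^sub>v x = c \<cdot>\<^sub>v x"
    by (auto simp: eigenvalue_def eigenvector_def)
  have row: "(\<Sum>j<n. of_real (A $$ (i, j)) * x $ j) = c * x $ i" if "i < n" for i
    using arg_cong[OF eq, of "\<lambda>y. y $ i"] that A x
    by (simp add: scalar_prod_def atLeast0LessThan)
  define q where "q = (\<Sum>i<n. \<Sum>j<n. cnj (x $ i) * (of_real (A $$ (i, j)) * x $ j))"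
  define r where "r = (\<Sum>i<n. (cmod (x $ i))\<^sup>2)"
  have "q = (\<Sum>i<n. cnj (x $ i) * (c * x $ i))"
    unfolding q_def by (simp add: sum_distrib_left[symmetric] row)
  also have "\<dots> = c * of_real r"
    unfolding r_def by (simp add: sum_distrib_left complex_norm_square mult_ac del: of_real_power)
  finally have q: "q = c * of_real r" .
  \<comment> \<open>Conjugation exchanges the roles of the two indices; the symmetry of
    \<open>A\<close> undoes the exchange.\<close>
  have "cnj q = (\<Sum>i<n. \<Sum>j<n. x $ i * (of_real (A $$ (i, j)) * cnj (x $ j)))"
    by (simp add: q_def)
  also have "\<dots> = (\<Sum>j<n. \<Sum>i<n. x $ i * (of_real (A $$ (i, j)) * cnj (x $ j)))"
    by (rule sum.swap)
  also have "\<dots> = q"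
    unfolding q_def by (intro sum.cong refl) (use sym in \<open>simp add: mult_ac\<close>)
  finally have "q \<in> \<real>" by (simp add: Reals_cnj_iff)
  have "r \<noteq> 0"
  proof
    assume "r = 0"
    then have "x $ i = 0" if "i < n" for i
      using that unfolding r_def by (simp add: sum_nonneg_eq_0_iff)
    then have "x = 0\<^sub>v n" using x by auto
    with x show False by simp
  qed
  with q have "c = q / of_real r" by simp
  with \<open>q \<in> \<real>\<close> show ?thesis by simp
qed

text \<open>The factorization exists over the complex numbers, and its roots are real. It is
  therefore the image of a product of real linear factors, and the embedding of real into complex
  polynomials is injective.\<close>

lemma symmetric_char_poly_splits:
  fixes A :: "real mat"
  assumes A: "A \<in> carrier_mat n n"
    and sym: "\<And>i j. i < n \<Longrightarrow> j < n \<Longrightarrow> A $$ (i, j) = A $$ (j, i)"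
  obtains es where "char_poly A = (\<Prod>e\<leftarrow>es. [:- e, 1:])" and "length es = n"
proof -
  let ?C = "map_mat complex_of_real A"
  have C: "?C \<in> carrier_mat n n" using A by simp
  obtain as where as: "char_poly ?C = (\<Prod>a\<leftarrow>as. [:- a, 1:])" "length as = n"
    using char_poly_factorized[OF C] by blast
  have "a \<in> \<real>" if "a \<in> set as" for a
  proof (rule symmetric_eigenvalue_real[OF A sym])
    show "eigenvalue ?C a"
      unfolding eigenvalue_root_char_poly[OF C] as(1)
      using that by (auto simp: poly_prod_list prod_list_zero_iff)
  qed
  then have re: "map (complex_of_real \<circ> Re) as = as"
    by (intro map_idI) (simp add: of_real_Re)
  interpret h: map_poly_inj_idom_hom complex_of_real ..
  have "map_poly complex_of_real (\<Prod>e\<leftarrow>map Re as. [:- e, 1:])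
      = (\<Prod>a\<leftarrow>map (complex_of_real \<circ> Re) as. [:- a, 1:])"
    by (simp add: h.hom_prod_list o_def)
  also have "\<dots> = char_poly ?C" using re as by simp
  also have "\<dots> = map_poly complex_of_real (char_poly A)"
    by (rule of_real_hom.char_poly_hom[OF A])
  finally have "char_poly A = (\<Prod>e\<leftarrow>map Re as. [:- e, 1:])"
    by (simp only: h.eq_iff)
  then show ?thesis using that[of "map Re as"] as by simp
qed

lemma proots_prod_linear_factors:
  "proots (\<Prod>e\<leftarrow>es. [:- e, 1:]) = mset (es :: 'b::idom list)"
proof (induction es)
  case (Cons e es)
  have "(\<Prod>e\<leftarrow>es. [:- e, 1:]) \<noteq> 0" by (auto simp: prod_list_zero_iff)
  then show ?case using Cons by (simp add: proots_mult del: mult_pCons_left)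
qed simp

text \<open>The sorted list is a permutation of the roots \<open>es\<close> of the split
  characteristic polynomial, so facts about \<open>es\<close> that ignore order carry over. Its
  length \<open>n\<close> keeps the list accesses made by \<open>eigval\<close> in range.\<close>

lemma symmetric_eigvals_desc:
  fixes A :: "real mat"
  assumes A: "A \<in> carrier_mat n n"
    and sym: "\<And>i j. i < n \<Longrightarrow> j < n \<Longrightarrow> A $$ (i, j) = A $$ (j, i)"
  shows "length (eigvals_desc A) = n"
    and "mat_trace (A ^\<^sub>m k) = (\<Sum>i<n. (eigvals_desc A ! i) ^ k)"
    and "e \<in> set (eigvals_desc A) \<Longrightarrow> eigenvalue A e"
    and "i \<le> j \<Longrightarrow> j < n \<Longrightarrow> eigvals_desc A ! j \<le> eigvals_desc A ! i"
proof -
  obtain es where es: "char_poly A = (\<Prod>e\<leftarrow>es. [:- e, 1:])" "length es = n"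
    using symmetric_char_poly_splits[OF A sym] by blast
  have ms: "mset (eigvals_desc A) = mset es"
    unfolding eigvals_desc_def es(1) proots_prod_linear_factors by simp
  show len: "length (eigvals_desc A) = n"
    using mset_eq_length[OF ms] es by simp
  have "mat_trace (A ^\<^sub>m k) = (\<Sum>e\<leftarrow>es. e ^ k)"
    by (rule mat_trace_power_eq_sum_list[OF A es(1)])
  also have "\<dots> = (\<Sum>e\<leftarrow>eigvals_desc A. e ^ k)"
    using ms by (simp flip: sum_mset_sum_list)
  finally show "mat_trace (A ^\<^sub>m k) = (\<Sum>i<n. (eigvals_desc A ! i) ^ k)"
    using len by (simp add: sum_list_sum_nth atLeast0LessThan)
  show "eigenvalue A e" if "e \<in> set (eigvals_desc A)"
  proof -
    have "e \<in> set es" using that ms by (metis set_mset_mset)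
    then show ?thesis unfolding eigenvalue_root_char_poly[OF A] es(1)
      by (auto simp: poly_prod_list prod_list_zero_iff)
  qed
  show "eigvals_desc A ! j \<le> eigvals_desc A ! i" if "i \<le> j" "j < n"
  proof -
    have "sorted (rev (eigvals_desc A))" by (simp add: eigvals_desc_def)
    then show ?thesis using that len by (simp add: sorted_rev_nth_mono)
  qed
qed

section \<open>The spectrum of the normalized Laplacian\<close>

context
  fixes G :: "'a pair_pre_digraph" and n :: nat and v :: "nat \<Rightarrow> 'a"
  assumes graph: "pair_graph G"
    and verts: "bij_betw v {..<n} (pverts G)"
    and no_isolated: "\<forall>x \<in> pverts G. deg G x \<noteq> 0"
begin

interpretation pair_graph G by (rule graph)

lemma adj_commute: "adj G x y \<longleftrightarrow> adj G y x"
  using pair_sym_arcs by (auto simp: adj_def symmetric_def sym_def)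

lemma not_adj_self: "\<not> adj G x x"
  unfolding adj_def using pair_no_loops[of "(x, x)"] by auto

text \<open>As \<open>v\<close> enumerates the vertices bijectively, arcs leaving \<open>x\<close>
  correspond to indices of neighbours. This makes the degree the number of terms in a sum over
  neighbours.\<close>

lemma deg_eq_card: "deg G x = card {j. j < n \<and> adj G x (v j)}"
proof -
  have "bij_betw (\<lambda>j. (x, v j)) {j. j < n \<and> adj G x (v j)} {e \<in> parcs G. fst e = x}"
  proof (rule bij_betwI')
    fix i j assume "i \<in> {j. j < n \<and> adj G x (v j)}" "j \<in> {j. j < n \<and> adj G x (v j)}"
    then show "((x, v i) = (x, v j)) = (i = j)"
      using verts by (auto simp: bij_betw_def inj_on_def)
  next
    fix e assume e: "e \<in> {e \<in> parcs G. fst e = x}"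
    then have "snd e \<in> v ` {..<n}"
      using arc_snd_in_verts verts by (auto simp: bij_betw_def)
    with e show "\<exists>j \<in> {j. j < n \<and> adj G x (v j)}. e = (x, v j)"
      by (cases e) (auto simp: adj_def)
  qed (auto simp: adj_def)
  then show ?thesis
    by (simp add: deg_def out_degree_def out_arcs_def with_proj_def bij_betw_same_card)
qed

lemma deg_pos: "i < n \<Longrightarrow> deg G (v i) > 0"
  using no_isolated verts by (auto simp: bij_betw_def)

lemma normalized_laplacian_carrier: "normalized_laplacian G n v \<in> carrier_mat n n"
  by (simp add: normalized_laplacian_def)

lemma normalized_laplacian_sym:
  "i < n \<Longrightarrow> j < n \<Longrightarrow>
    normalized_laplacian G n v $$ (i, j) = normalized_laplacian G n v $$ (j, i)"
  by (auto simp: normalized_laplacian_def mult.commute adj_commute)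

lemma normalized_laplacian_eigenvalue_nonneg:
  assumes "eigenvalue (normalized_laplacian G n v) e"
  shows "e \<ge> 0"
proof -
  let ?L = "normalized_laplacian G n v"
  let ?N = "\<lambda>i. {j. j < n \<and> adj G (v i) (v j)}"
  let ?d = "\<lambda>i. real (deg G (v i))"
  from assms obtain x where x: "x \<in> carrier_vec n" "x \<noteq> 0\<^sub>v n" and eq: "?L *\<^sub>v x = e \<cdot>\<^sub>v x"
    by (auto simp: eigenvalue_def eigenvector_def normalized_laplacian_def)
  \<comment> \<open>This rescaling carries the normalized Laplacian into the identity minus the
    average over neighbours.\<close>
  define y where "y i = x $ i / sqrt (?d i)" for i
  have xy: "x $ i = sqrt (?d i) * y i" if "i < n" for i
    using deg_pos[OF that] by (simp add: y_def)
  have "n > 0" using x by (cases n) auto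
  \<comment> \<open>\<open>1 - e\<close> is an eigenvalue, with eigenvector \<open>y\<close>, of the averaging operator over
      neighbours, which cannot increase the largest modulus.\<close>
  obtain i where i: "i < n" and max: "\<And>j. j < n \<Longrightarrow> \<bar>y j\<bar> \<le> \<bar>y i\<bar>"
  proof -
    have "Max ((\<lambda>i. \<bar>y i\<bar>) ` {..<n}) \<in> (\<lambda>i. \<bar>y i\<bar>) ` {..<n}"
      using \<open>n > 0\<close> by (intro Max_in) auto
    then obtain i where "i < n" "Max ((\<lambda>i. \<bar>y i\<bar>) ` {..<n}) = \<bar>y i\<bar>" by auto
    then show ?thesis using that[of i] by (metis Max_ge finite_imageI finite_lessThan imageI lessThan_iff)
  qed
  have "y i \<noteq> 0"
  proof
    assume "y i = 0"
    then have "x $ j = 0" if "j < n" for j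
      using max[OF that] xy[OF that] by simp
    then have "x = 0\<^sub>v n" using x by auto
    with x show False by simp
  qed
  have d: "?d i > 0" using deg_pos[OF i] by simp
  have "e * x $ i = (\<Sum>j<n. ?L $$ (i, j) * x $ j)"
    using arg_cong[OF eq, of "\<lambda>y. y $ i"] i x
    by (simp add: normalized_laplacian_def scalar_prod_def atLeast0LessThan)
  also have "\<dots> = (\<Sum>j<n. (if j = i then x $ i else 0) - (if adj G (v i) (v j) then y j / sqrt (?d i) else 0))"
  proof (intro sum.cong refl)
    fix j assume "j \<in> {..<n}"
    then show "?L $$ (i, j) * x $ j = (if j = i then x $ i else 0)
        - (if adj G (v i) (v j) then y j / sqrt (?d i) else 0)"
      using i deg_pos[of j] not_adj_self
      by (auto simp: normalized_laplacian_def y_def real_sqrt_mult)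
  qed
  also have "\<dots> = x $ i - (\<Sum>j<n. if adj G (v i) (v j) then y j / sqrt (?d i) else 0)"
    using i by (simp add: sum_subtractf)
  also have "(\<Sum>j<n. if adj G (v i) (v j) then y j / sqrt (?d i) else 0)
      = (\<Sum>j\<in>?N i. y j / sqrt (?d i))"
    by (simp add: sum.If_cases Int_def conj_commute)
  also have "\<dots> = (\<Sum>j\<in>?N i. y j) / sqrt (?d i)"
    by (simp add: sum_divide_distrib)
  finally have "(1 - e) * (sqrt (?d i) * y i) = (\<Sum>j\<in>?N i. y j) / sqrt (?d i)"
    by (simp add: xy[OF i] algebra_simps)
  then have "(1 - e) * (?d i * y i) = (\<Sum>j\<in>?N i. y j)"
    using d by (simp add: field_simps)
  then have "\<bar>1 - e\<bar> * (?d i * \<bar>y i\<bar>) = \<bar>\<Sum>j\<in>?N i. y j\<bar>"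
    by (metis abs_mult abs_of_nat)
  \<comment> \<open>Each of the \<open>?d i\<close> neighbours contributes at most the maximal
    modulus; cancelling the positive factor \<open>?d i * \<bar>y i\<bar>\<close> then bounds
    \<open>\<bar>1 - e\<bar>\<close>.\<close>
  also have "\<dots> \<le> (\<Sum>j\<in>?N i. \<bar>y i\<bar>)"
    by (rule order_trans[OF sum_abs sum_mono], use max in auto)
  also have "\<dots> = ?d i * \<bar>y i\<bar>" by (simp add: deg_eq_card)
  finally have "\<bar>1 - e\<bar> \<le> 1"
    using d \<open>y i \<noteq> 0\<close> by simp
  then show ?thesis by simp
qed

text \<open>This identifies the mean of the squared eigenvalues with \<open>m\<close>. The unit
  diagonal contributes \<open>n\<close>, and each edge occurs in both orientations, whence the
  factor 2.\<close>

lemma mat_trace_normalized_laplacian_square: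
  "mat_trace (normalized_laplacian G n v ^\<^sub>m 2) = real n +
    2 * (\<Sum>(i, j) \<in> {(i, j). i < j \<and> j < n \<and> adj G (v i) (v j)}.
         1 / (real (deg G (v i)) * real (deg G (v j))))"
proof -
  let ?L = "normalized_laplacian G n v"
  let ?w = "\<lambda>(i, j). 1 / (real (deg G (v i)) * real (deg G (v j)))"
  let ?E = "{(i, j). i < j \<and> j < n \<and> adj G (v i) (v j)}"
  let ?A = "{(i, j). i < n \<and> j < n \<and> adj G (v i) (v j)}"
  have fin: "finite ?A"
    by (rule finite_subset[of _ "{..<n} \<times> {..<n}"]) auto
  \<comment> \<open>Without loops, every arc is either increasing or the reversal of an increasing
    one, never both.\<close>
  have A: "?A = ?E \<union> prod.swap ` ?E"
  proof (rule Set.set_eqI, rule iffI)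
    fix p assume "p \<in> ?A"
    then obtain i j where p: "p = (i, j)" "i < n" "j < n" "adj G (v i) (v j)" by auto
    then have "i \<noteq> j" using not_adj_self by auto
    then show "p \<in> ?E \<union> prod.swap ` ?E"
      using p adj_commute by (cases "i < j") (auto simp: image_iff)
  qed (use adj_commute in \<open>auto dest: less_trans\<close>)
  have "(\<Sum>p\<in>prod.swap ` ?E. ?w p) = (\<Sum>p\<in>?E. ?w p)"
    by (subst sum.reindex) (auto simp: mult.commute intro!: sum.cong)
  then have sumA: "(\<Sum>p\<in>?A. ?w p) = 2 * (\<Sum>p\<in>?E. ?w p)"
    unfolding A using fin[unfolded A] by (subst sum.union_disjoint) auto
  have "mat_trace (?L ^\<^sub>m 2) = (\<Sum>i<n. \<Sum>j<n. ?L $$ (i, j) * ?L $$ (j, i))"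
    using normalized_laplacian_carrier
    by (auto simp: numeral_2_eq_2 mat_trace_def scalar_prod_def atLeast0LessThan intro!: sum.cong)
  also have "\<dots> = (\<Sum>i<n. \<Sum>j<n. (if j = i then 1 else 0) + (if adj G (v i) (v j) then ?w (i, j) else 0))"
  proof (intro sum.cong refl)
    fix i j assume "i \<in> {..<n}" "j \<in> {..<n}"
    then show "?L $$ (i, j) * ?L $$ (j, i)
        = (if j = i then 1 else 0) + (if adj G (v i) (v j) then ?w (i, j) else 0)"
      using not_adj_self normalized_laplacian_sym[of i j]
      by (auto simp: normalized_laplacian_def)
  qed
  also have "\<dots> = real n + (\<Sum>(i, j)\<in>{..<n} \<times> {..<n}. if adj G (v i) (v j) then ?w (i, j) else 0)"
    by (simp add: sum.distrib sum.cartesian_product)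
  also have "(\<Sum>(i, j)\<in>{..<n} \<times> {..<n}. if adj G (v i) (v j) then ?w (i, j) else 0) = (\<Sum>p\<in>?A. ?w p)"
    by (rule sum.mono_neutral_cong_right) (auto split: if_splits)
  finally show ?thesis using sumA by simp
qed

end

section \<open>Extreme values in terms of mean and variance\<close>

text \<open>\<open>S\<close> is n times the variance. The second moment is given in raw form because
  traces of powers deliver it so.\<close>

locale mean_variance =
  fixes n :: nat and y :: "nat \<Rightarrow> real" and \<mu> S :: real
  assumes n: "n \<ge> 2"
    and mean: "(\<Sum>i<n. y i) = n * \<mu>"
    and variance: "(\<Sum>i<n. (y i)\<^sup>2) = n * \<mu>\<^sup>2 + S"
begin

text \<open>The parallel axis identity. The facts below come from different choices of the centre
  \<open>c\<close>.\<close>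

lemma sum_deviation_square: "(\<Sum>i<n. (y i - c)\<^sup>2) = S + n * (\<mu> - c)\<^sup>2"
  by (simp add: power2_diff sum.distrib sum_subtractf variance flip: sum_distrib_left sum_distrib_right)
    (simp add: mean algebra_simps flip: sum_distrib_left sum_distrib_right)

lemma nonneg: "S \<ge> 0"
  using sum_deviation_square[of \<mu>] sum_nonneg[of "{..<n}" "\<lambda>i. (y i - \<mu>)\<^sup>2"] by simp

text \<open>Centre at the maximum: the deviations \<open>y k - y i\<close> are nonnegative, so the
  sum of their squares is at most the square of their sum, which is
  \<open>n * (y k - \<mu>)\<close>.\<close>

lemma max_ge:
  assumes k: "k < n" and max: "\<And>i. i < n \<Longrightarrow> y i \<le> y k"
  shows "\<mu> + sqrt (S / (n * (real n - 1))) \<le> y k"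
proof -
  have tot: "(\<Sum>i<n. y k - y i) = n * (y k - \<mu>)"
    by (simp add: sum_subtractf mean algebra_simps)
  have ge: "y k \<ge> \<mu>"
    using sum_nonneg[of "{..<n}" "\<lambda>i. y k - y i"] max n by (simp add: tot zero_le_mult_iff)
  have "S + n * (y k - \<mu>)\<^sup>2 = (\<Sum>i<n. (y k - y i) * (y k - y i))"
    using sum_deviation_square[of "y k"] by (simp add: power2_eq_square algebra_simps)
  \<comment> \<open>A single nonnegative deviation is at most the total.\<close>
  also have "\<dots> \<le> (\<Sum>i<n. (y k - y i) * (\<Sum>j<n. y k - y j))"
    using max by (intro sum_mono mult_left_mono member_le_sum) auto
  also have "\<dots> = (n * (y k - \<mu>))\<^sup>2"
    by (simp add: tot power2_eq_square flip: sum_distrib_right)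
  finally have "S \<le> (y k - \<mu>)\<^sup>2 * (n * (real n - 1))"
    by (simp add: power2_eq_square algebra_simps)
  then have "S / (n * (real n - 1)) \<le> (y k - \<mu>)\<^sup>2"
    using n by (simp add: pos_divide_le_eq)
  then have "sqrt (S / (n * (real n - 1))) \<le> y k - \<mu>"
    using ge by (intro real_le_lsqrt) auto
  then show ?thesis by simp
qed

lemma le:
  assumes k: "k < n"
  shows "y k \<le> \<mu> + sqrt (S / n * (real n - 1))"
proof -
  define a where "a = y k - \<mu>"
  define c where "c = \<mu> - a / (real n - 1)"
  \<comment> \<open>\<open>c\<close> is the mean of the entries other than \<open>y k\<close>.\<close>
  have n1: "real n - 1 > 0" using n by simp
  \<comment> \<open>Of the squared deviations from \<open>c\<close> only the one at \<open>k\<close>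
    is kept; this centre makes the sum of the discarded ones smallest.\<close>
  have "(y k - c)\<^sup>2 \<le> S + n * (\<mu> - c)\<^sup>2"
    unfolding sum_deviation_square[symmetric] using k by (intro member_le_sum) auto
  moreover have "y k - c = a * n / (real n - 1)"
    using n1 by (simp add: c_def a_def field_simps)
  moreover have "\<mu> - c = a / (real n - 1)" by (simp add: c_def)
  ultimately have "(a * n / (real n - 1))\<^sup>2 \<le> S + n * (a / (real n - 1))\<^sup>2" by simp
  \<comment> \<open>The numerator is \<open>(a * n)\<^sup>2 - n * a\<^sup>2\<close>.\<close>
  then have "a\<^sup>2 * n * (real n - 1) / (real n - 1)\<^sup>2 \<le> S"
    by (simp add: power_divide power_mult_distrib power2_eq_square diff_divide_distrib algebra_simps)
  then have "a\<^sup>2 * n / (real n - 1) \<le> S"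
    using n1 by (simp add: power2_eq_square)
  then have "a\<^sup>2 \<le> S / n * (real n - 1)"
    using n n1 by (simp add: field_simps)
  then have "a \<le> sqrt (S / n * (real n - 1))" by (rule real_le_rsqrt)
  then show ?thesis by (simp add: a_def)
qed

end

section \<open>The bounds for the extreme eigenvalues\<close>

theorem theorem2:
  fixes G :: "'a pair_pre_digraph" and n :: nat and v :: "nat \<Rightarrow> 'a"
    and L :: "real mat" and m :: real
  assumes graph: "pair_graph G"
    and verts: "bij_betw v {..<n} (pverts G)"
    and n: "n \<ge> 2"
    and no_isolated: "\<forall>x \<in> pverts G. deg G x \<noteq> 0"
    and L: "L = normalized_laplacian G n v"
    and m: "m = 1 + 2 / real n *
      (\<Sum>(i, j) \<in> {(i, j). i < j \<and> j < n \<and> adj G (v i) (v j)}.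
         1 / (real (deg G (v i)) * real (deg G (v j))))"
  shows "eigval L n \<le>
           sqrt (m + sqrt ((mat_trace (L ^\<^sub>m 4) - real n * m\<^sup>2) / (real n * (real n - 1))))
       \<and> eigval L 1 \<ge>
           sqrt (m + sqrt ((mat_trace (L ^\<^sub>m 4) - real n * m\<^sup>2) / (real n * (real n - 1))))
       \<and> eigval L 1 \<le>
           sqrt (m + sqrt ((mat_trace (L ^\<^sub>m 4) / real n - m\<^sup>2) * (real n - 1)))"
proof -
  note graph_facts = graph verts no_isolated
  have carrier: "L \<in> carrier_mat n n"
    unfolding L by (rule normalized_laplacian_carrier[OF graph_facts])
  have sym: "L $$ (i, j) = L $$ (j, i)" if "i < n" "j < n" for i j
    unfolding L by (rule normalized_laplacian_sym[OF graph_facts that])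
  note spec = symmetric_eigvals_desc[OF carrier sym]
  \<comment> \<open>Positions start at 0, so \<open>e 0\<close> is \<open>eigval L 1\<close> and
    \<open>e (n - 1)\<close> is \<open>eigval L n\<close>.\<close>
  define e where "e i = eigvals_desc L ! i" for i
  \<comment> \<open>Hence squaring keeps the order of the eigenvalues, and a lower bound for a
    square passes to its root.\<close>
  have e_nonneg: "e i \<ge> 0" if "i < n" for i
    using normalized_laplacian_eigenvalue_nonneg[OF graph_facts, of "e i"] spec(1,3) that
    by (simp add: L e_def)
  have "(\<Sum>i<n. (e i)\<^sup>2) = n * m"
    using spec(2)[of 2] mat_trace_normalized_laplacian_square[OF graph_facts] n
    by (simp add: L e_def m algebra_simps)
  moreover have "(\<Sum>i<n. ((e i)\<^sup>2)\<^sup>2) = mat_trace (L ^\<^sub>m 4)"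
    using spec(2)[of 4] by (simp add: e_def flip: power_mult)
  \<comment> \<open>The third parameter is the numerator in the first two bounds; divided by
    \<open>n\<close> it is the difference in the third.\<close>
  ultimately interpret mean_variance n "\<lambda>i. (e i)\<^sup>2" m "mat_trace (L ^\<^sub>m 4) - n * m\<^sup>2"
    using n by unfold_locales auto
  \<comment> \<open>The smallest square is at most the mean. The first bound follows, because the
    inner root is nonnegative.\<close>
  have min: "(e (n - 1))\<^sup>2 \<le> m"
  proof -
    have "(\<Sum>i<n. (e (n - 1))\<^sup>2) \<le> (\<Sum>i<n. (e i)\<^sup>2)"
      using e_nonneg spec(4) n by (intro sum_mono power_mono) (auto simp: e_def)
    then show ?thesis using mean n by simp
  qed
  have max: "(e i)\<^sup>2 \<le> (e 0)\<^sup>2" if "i < n" for i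
    using that e_nonneg spec(4)[of 0 i] by (intro power_mono) (auto simp: e_def)
  have "e (n - 1) \<le> sqrt (m + sqrt ((mat_trace (L ^\<^sub>m 4) - n * m\<^sup>2) / (n * (real n - 1))))"
    using min nonneg n by (intro real_le_rsqrt order_trans[OF min]) auto
  moreover have "sqrt (m + sqrt ((mat_trace (L ^\<^sub>m 4) - n * m\<^sup>2) / (n * (real n - 1)))) \<le> e 0"
    using max_ge[of 0] max e_nonneg[of 0] n by (intro real_le_lsqrt) auto
  moreover have "e 0 \<le> sqrt (m + sqrt ((mat_trace (L ^\<^sub>m 4) / n - m\<^sup>2) * (real n - 1)))"
    using le[of 0] n by (intro real_le_rsqrt) (simp add: diff_divide_distrib)
  ultimately show ?thesis by (simp add: eigval_def e_def)
qed

end
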